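(* Let $n$ be a positive integer. The flow polynomial of the complete graph $K_n$ satisfies $$F_{K_n}(x)=\frac{(-1)^{\frac12 n(n-1)}}{x^n}\left.\left(\frac{\partial^n}{\partial z^n}\Bigl\{\sum_{i=0}^n\frac{z^i}{i!}(1-x)^{\frac12 i(i-1)}\Bigr\}^x\right)\right|_{z=0}.$$
   Context: The flow polynomial $F_G$ of a graph $G=(V,E)$ is the polynomial such that, for every positive integer $q$, $F_G(q)$ is the number of nowhere-zero flows with values in $\mathbb{Z}_q=\mathbb{Z}/q\mathbb{Z}$: after fixing any orientation of the edges, these are the assignments of a nonzero element $k_e\in\mathbb{Z}_q$ to each edge $e$ such that at every vertex the sum of $k_e$ over incoming edges equals the sum over outgoing edges. Equivalently, $F_G$ is the characteristic polynomial $\chi_{M}(x)=\sum_{A\subseteq E}(-1)^{|A|}x^{r_M(E)-r_M(A)}$ of the dual $M=M_G^*$ of the graphic matroid $M_G$ of $G$. The expression $\{\cdot\}^x$ is the $x$-th power of a polynomial in $z$ with constant term $1$, understood as the formal power series $\{1+h(z)\}^x=\sum_{j\ge0}\frac{x(x-1)\cdots(x-j+1)}{j!}h(z)^j$ (equivalently, for real $x\ne 0$, the usual real power for $z$ near $0$). The conventions $(1-x)^0=1$ and $z^0=1$ are used. *)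

theory Defs
  imports
    "HOL-Computational_Algebra.Formal_Power_Series"
    "HOL-Computational_Algebra.Polynomial"
    "HOL-Number_Theory.Cong"
    "HOL-Library.FuncSet"
    "Graph_Theory.Digraph"
begin

text \<open>
  Undirected graphs; \<open>ends e\<close> is the set of end points of \<open>e\<close>, a singleton for a loop,
  so that loops and parallel edges are allowed.
\<close>

record ('v, 'e) ugraph =
  vertices :: "'v set"
  edges :: "'e set"
  ends :: "'e \<Rightarrow> 'v set"

definition is_orientation :: "('v, 'e) ugraph \<Rightarrow> ('v, 'e) pre_digraph \<Rightarrow> bool" where
  "is_orientation G D \<longleftrightarrow>
     verts D = vertices G \<and> arcs D = edges G \<and>
     (\<forall>e \<in> edges G. ends G e = {tail D e, head D e})"

text \<open>
  The nonzero elements of \<open>\<int>/q\<int>\<close> are represented by the integers in \<open>{1..<q}\<close>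
  (there are none for \<open>q = 1\<close>). Flows are extensional functions, so that distinct
  elements of this set are distinct assignments on the edges.
\<close>

definition nowhere_zero_flows :: "('v, 'e) pre_digraph \<Rightarrow> nat \<Rightarrow> ('e \<Rightarrow> int) set" where
  "nowhere_zero_flows D q =
     {k \<in> arcs D \<rightarrow>\<^sub>E {1..<int q}.
        \<forall>v \<in> verts D. [(\<Sum>e\<in>in_arcs D v. k e) = (\<Sum>e\<in>out_arcs D v. k e)] (mod int q)}"

definition flow_polynomial :: "('v, 'e) ugraph \<Rightarrow> int poly" where
  "flow_polynomial G =
     (THE p. \<forall>q::nat. q > 0 \<longrightarrow>
        (\<forall>D. is_orientation G D \<longrightarrow> poly p (int q) = int (card (nowhere_zero_flows D q))))"

definition complete_ugraph :: "nat \<Rightarrow> (nat, nat set) ugraph" where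
  "complete_ugraph n =
     \<lparr>vertices = {1..n}, edges = {e. e \<subseteq> {1..n} \<and> card e = 2}, ends = (\<lambda>e. e)\<rparr>"

text \<open>
  The power \<open>f\<^sup>x = (\<Sum>j. (x gchoose j) * (f - 1) ^ j)\<close> of a formal power series \<open>f\<close>
  with constant term 1; the coefficients of \<open>f\<close> may depend on \<open>x\<close>.
\<close>

definition fps_gpower :: "'a::field_char_0 fps \<Rightarrow> 'a \<Rightarrow> 'a fps" where
  "fps_gpower f x = fps_compose (fps_binomial x) (f - 1)"

end

theory Submission
  imports Defs
begin

text \<open>
  Contracting an arc that is not a loop merges the conservation laws at its ends, and the value
  on the contracted arc is then forced; it vanishes exactly for the flows of the graph with the
  arc deleted. Hence the number \<open>N(q)\<close> of nowhere-zero flows satisfies the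
  deletion-contraction recurrence, which shows that it is an integer polynomial in \<open>q\<close> and that
  \<open>q\<^bsup>|V|\<^esup> N(q) = (\<Sum>\<phi> : V \<rightarrow> [q]. \<Prod>uv \<in> E. q [\<phi> u = \<phi> v] - 1)\<close>,
  because the right-hand side, a Potts partition function, obeys the same recurrence up to
  the factor \<open>q\<close>. For \<open>K\<^sub>n\<close> the summand depends only on the sizes of the colour classes, and the
  exponential formula turns the sum into the \<open>q\<close>-th power of the generating function in the
  theorem. Both sides of the theorem, multiplied by \<open>x\<^sup>n\<close>, are polynomials in \<open>x\<close>, so agreement
  at the positive integers suffices.
\<close>

section \<open>Nowhere-zero flows under deletion and contraction\<close>

definition excess :: "('e \<Rightarrow> 'v) \<Rightarrow> ('e \<Rightarrow> 'v) \<Rightarrow> 'e set \<Rightarrow> ('e \<Rightarrow> int) \<Rightarrow> 'v \<Rightarrow> int" where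
  "excess t h E k v = (\<Sum>e\<in>E. k e * (of_bool (h e = v) - of_bool (t e = v)))"

text \<open>The graph is unbundled into vertex set, end maps and edge set, so that an induction on
  \<open>E\<close> can remove one edge while contraction changes \<open>V\<close>, \<open>t\<close>
  and \<open>h\<close>.\<close>

definition zflows :: "'v set \<Rightarrow> ('e \<Rightarrow> 'v) \<Rightarrow> ('e \<Rightarrow> 'v) \<Rightarrow> 'e set \<Rightarrow> nat \<Rightarrow> ('e \<Rightarrow> int) set" where
  "zflows V t h E q = {k \<in> E \<rightarrow>\<^sub>E {1..<int q}. \<forall>v\<in>V. int q dvd excess t h E k v}"

text \<open>Applied to both end maps, this glues the vertex \<open>b\<close> onto \<open>a\<close>.
  Edges parallel to a contracted edge between \<open>a\<close> and \<open>b\<close> become loops at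
  \<open>a\<close>.\<close>

definition redirect :: "'v \<Rightarrow> 'v \<Rightarrow> ('e \<Rightarrow> 'v) \<Rightarrow> 'e \<Rightarrow> 'v" where
  "redirect a b f e = (if f e = b then a else f e)"

lemma finite_zflows: "finite E \<Longrightarrow> finite (zflows V t h E q)"
  unfolding zflows_def by (rule finite_subset[of _ "E \<rightarrow>\<^sub>E {1..<int q}"]) (auto intro: finite_PiE)

text \<open>Inflow minus outflow is a single sum over all arcs weighted by the difference of the
  head and tail indicators; a loop is counted in both sums and cancels.\<close>

lemma nowhere_zero_flows_eq_zflows:
  assumes "finite (arcs D)"
  shows "nowhere_zero_flows D q = zflows (verts D) (tail D) (head D) (arcs D) q"
proof -
  have "excess (tail D) (head D) (arcs D) k v = sum k (in_arcs D v) - sum k (out_arcs D v)" for k v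
  proof -
    have "sum k (in_arcs D v) = (\<Sum>e\<in>arcs D. if head D e = v then k e else 0)"
      by (simp add: in_arcs_def sum.inter_filter[OF assms])
    moreover have "sum k (out_arcs D v) = (\<Sum>e\<in>arcs D. if tail D e = v then k e else 0)"
      by (simp add: out_arcs_def sum.inter_filter[OF assms])
    ultimately show ?thesis
      unfolding excess_def by (simp add: sum_subtractf[symmetric]) (auto intro!: sum.cong)
  qed
  then show ?thesis
    unfolding nowhere_zero_flows_def zflows_def by (simp add: cong_iff_dvd_diff)
qed

lemma excess_cong: "(\<And>e. e \<in> E \<Longrightarrow> k e = k' e) \<Longrightarrow> excess t h E k v = excess t h E k' v"
  unfolding excess_def by (auto intro: sum.cong)

lemma excess_insert:
  assumes "finite E" "e \<notin> E"
  shows "excess t h (insert e E) k v =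
    excess t h E k v + k e * (of_bool (h e = v) - of_bool (t e = v))"
  using assms by (simp add: excess_def)

text \<open>Gluing adds the indicators of \<open>a\<close> and \<open>b\<close>, so the merged
  vertex receives both excesses, and edges between the two cancel. No other vertex notices.\<close>

lemma excess_redirect:
  assumes "a \<noteq> b" "v \<noteq> b"
  shows "excess (redirect a b t) (redirect a b h) E k v =
    excess t h E k v + (if v = a then excess t h E k b else 0)"
proof (cases "v = a")
  case True
  then show ?thesis using assms
    unfolding excess_def redirect_def by (auto simp: sum.distrib[symmetric] intro!: sum.cong)
next
  case False
  then show ?thesis using assms
    unfolding excess_def redirect_def by (auto intro!: sum.cong)
qed

text \<open>A loop enters and leaves the same vertex, so it drops out of every conservation law and
  its value ranges freely over the \<open>q - 1\<close> nonzero residues.\<close>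

lemma card_zflows_loop:
  assumes "finite E" "e \<notin> E" "t e = h e" "q > 0"
  shows "card (zflows V t h (insert e E) q) = (q - 1) * card (zflows V t h E q)"
proof -
  have "bij_betw (\<lambda>(c, k). k(e := c)) ({1..<int q} \<times> zflows V t h E q) (zflows V t h (insert e E) q)"
  proof (rule bij_betw_byWitness[where f' = "\<lambda>k. (k e, restrict k E)"])
    show "\<forall>x\<in>{1..<int q} \<times> zflows V t h E q.
        (\<lambda>k. (k e, restrict k E)) ((\<lambda>(c, k). k(e := c)) x) = x"
      using assms(2) by (auto simp: zflows_def PiE_def extensional_def fun_eq_iff restrict_def)
    show "\<forall>k\<in>zflows V t h (insert e E) q. (\<lambda>(c, k). k(e := c)) (k e, restrict k E) = k"
      using assms(2) by (auto simp: zflows_def PiE_def extensional_def fun_eq_iff restrict_def)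
    have *: "excess t h E (k(e := c)) v = excess t h E k v" for k c v
      using assms(2) by (intro excess_cong) auto
    have **: "excess t h E (restrict k E) v = excess t h E k v" for k v
      by (intro excess_cong) auto
    show "(\<lambda>(c, k). k(e := c)) ` ({1..<int q} \<times> zflows V t h E q) \<subseteq> zflows V t h (insert e E) q"
      using assms by (auto simp: zflows_def excess_insert * PiE_iff extensional_def)
    show "(\<lambda>k. (k e, restrict k E)) ` zflows V t h (insert e E) q \<subseteq> {1..<int q} \<times> zflows V t h E q"
      using assms by (auto simp: zflows_def excess_insert ** PiE_iff extensional_def)
  qed
  then have "card (zflows V t h (insert e E) q) = card ({1..<int q} \<times> zflows V t h E q)"
    by (simp add: bij_betw_same_card)
  then show ?thesis
    by (simp add: card_cartesian_product nat_diff_distrib')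
qed

text \<open>Flows of the contraction are split by their excess at \<open>b\<close>. If it vanishes
  mod \<open>q\<close>, so does the excess at \<open>a\<close>, and the flow is one of the deletion.
  Otherwise exactly one nonzero value on \<open>e\<close> restores the balance at both ends.\<close>

lemma card_zflows_deletion_contraction:
  assumes fin: "finite E" and e: "e \<notin> E" and ab: "t e = a" "h e = b" "a \<noteq> b"
    and V: "a \<in> V" "b \<in> V" and q: "q > 0"
  shows "card (zflows V t h (insert e E) q) + card (zflows V t h E q) =
    card (zflows (V - {b}) (redirect a b t) (redirect a b h) E q)"
proof -
  let ?A = "zflows V t h (insert e E) q" and ?B = "zflows V t h E q"
  let ?S = "zflows (V - {b}) (redirect a b t) (redirect a b h) E q"
  let ?x = "\<lambda>k. excess t h E k"
  \<comment> \<open>Conservation away from the ends of \<open>e\<close> is the same for all three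
    graphs; isolating it leaves only the conditions at \<open>a\<close> and \<open>b\<close> to
    compare.\<close>
  define P where "P k \<longleftrightarrow> (\<forall>v\<in>V - {a, b}. int q dvd ?x k v)" for k
  have S: "k \<in> ?S \<longleftrightarrow> k \<in> E \<rightarrow>\<^sub>E {1..<int q} \<and> P k \<and> int q dvd ?x k a + ?x k b" for k
    using ab V by (auto simp: zflows_def excess_redirect P_def)
  have B: "k \<in> ?B \<longleftrightarrow> k \<in> E \<rightarrow>\<^sub>E {1..<int q} \<and> P k \<and> int q dvd ?x k a \<and> int q dvd ?x k b" for k
    using V by (auto simp: zflows_def P_def)
  have A: "k \<in> ?A \<longleftrightarrow> k \<in> insert e E \<rightarrow>\<^sub>E {1..<int q} \<and> P k \<and>
      int q dvd ?x k a - k e \<and> int q dvd ?x k b + k e" for k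
    using V ab by (auto simp: zflows_def P_def excess_insert[OF fin e])
  have upd: "?x (k(e := c)) v = ?x k v" for k c v
    using e by (intro excess_cong) auto
  have res: "?x (restrict k E) v = ?x k v" for k v
    by (intro excess_cong) auto
  have Pupd: "P (k(e := c)) = P k" and Pres: "P (restrict k E) = P k" for k c
    by (simp_all add: P_def upd res)
  \<comment> \<open>Since \<open>e\<close> enters \<open>b\<close>, conservation at \<open>b\<close>
    forces its value to be minus the excess of the other edges there; \<open>mod int q\<close> picks
    the representative, which is nonzero exactly outside \<open>?B\<close>.\<close>
  have "bij_betw (\<lambda>k. restrict k E) ?A (?S - ?B)"
  proof (rule bij_betw_byWitness[where f' = "\<lambda>k. k(e := (- ?x k b) mod int q)"])
    show "\<forall>k\<in>?A. (restrict k E)(e := (- ?x (restrict k E) b) mod int q) = k"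
    proof
      fix k assume k: "k \<in> ?A"
      then have "(- ?x k b) mod int q = k e mod int q"
        unfolding A mod_eq_dvd_iff by (metis dvd_minus_iff minus_add_distrib uminus_add_conv_diff
            add.commute diff_minus_eq_add minus_diff_eq)
      moreover have "k e mod int q = k e"
        using k unfolding A by (auto simp: PiE_iff)
      ultimately show "(restrict k E)(e := (- ?x (restrict k E) b) mod int q) = k"
        using k unfolding A res by (auto simp: fun_eq_iff PiE_def extensional_def restrict_def)
    qed
    show "\<forall>k\<in>?S - ?B. restrict (k(e := (- ?x k b) mod int q)) E = k"
      using e by (auto simp: S fun_eq_iff PiE_def extensional_def restrict_def)
    show "(\<lambda>k. restrict k E) ` ?A \<subseteq> ?S - ?B"
    proof (rule image_subsetI)
      fix k assume k: "k \<in> ?A"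
      then have *: "int q dvd ?x k a - k e" "int q dvd ?x k b + k e" "1 \<le> k e" "k e < int q"
        unfolding A by (auto simp: PiE_iff)
      have "int q dvd (?x k a - k e) + (?x k b + k e)"
        using *(1,2) by (rule dvd_add)
      then have "int q dvd ?x k a + ?x k b" by simp
      moreover have "\<not> int q dvd ?x k b"
      proof
        assume "int q dvd ?x k b"
        then have "int q dvd k e" using *(2) by (simp add: dvd_add_right_iff)
        then show False using *(3,4) zdvd_not_zless by force
      qed
      moreover have "restrict k E \<in> E \<rightarrow>\<^sub>E {1..<int q}"
        using k unfolding A by (auto simp: PiE_iff)
      ultimately show "restrict k E \<in> ?S - ?B"
        using k by (simp add: S B A Pres res)
    qed
    show "(\<lambda>k. k(e := (- ?x k b) mod int q)) ` (?S - ?B) \<subseteq> ?A"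
    proof (rule image_subsetI)
      fix k assume k: "k \<in> ?S - ?B"
      let ?c = "(- ?x k b) mod int q"
      have sum: "int q dvd ?x k a + ?x k b" and Pk: "P k" and kE: "k \<in> E \<rightarrow>\<^sub>E {1..<int q}"
        using k by (auto simp: S)
      have nb: "\<not> int q dvd ?x k b"
      proof
        assume *: "int q dvd ?x k b"
        then have "int q dvd ?x k a" using sum by (simp add: dvd_add_left_iff)
        then show False using k * by (auto simp: S B)
      qed
      have "?c \<noteq> 0" using nb by (simp add: mod_eq_0_iff_dvd)
      then have c: "?c \<in> {1..<int q}"
        using q pos_mod_sign[of "int q" "- ?x k b"] pos_mod_bound[of "int q" "- ?x k b"]
        unfolding atLeastLessThan_iff by linarith
      have d1: "int q dvd ?x k b + ?c"
      proof -
        have "?x k b + ?c = - (int q * ((- ?x k b) div int q))"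
          using mult_div_mod_eq[of "int q" "- ?x k b"] by linarith
        then show ?thesis by simp
      qed
      \<comment> \<open>Subtracting the law at \<open>b\<close> from the merged law leaves the law
        at \<open>a\<close>.\<close>
      have "int q dvd (?x k a + ?x k b) - (?x k b + ?c)"
        using sum d1 by (rule dvd_diff)
      then have d2: "int q dvd ?x k a - ?c" by simp
      have "k(e := ?c) \<in> insert e E \<rightarrow>\<^sub>E {1..<int q}"
        using kE c by (auto simp: PiE_iff extensional_def)
      then show "k(e := ?c) \<in> ?A"
        unfolding A Pupd upd using Pk d1 d2 by simp
    qed
  qed
  then have "card ?A = card (?S - ?B)" by (rule bij_betw_same_card)
  moreover have sub: "?B \<subseteq> ?S" by (auto simp: S B)
  moreover have "card ?B \<le> card ?S" by (rule card_mono[OF finite_zflows[OF fin] sub])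
  moreover have "card (?S - ?B) = card ?S - card ?B"
    by (rule card_Diff_subset[OF finite_zflows[OF fin] sub])
  ultimately show ?thesis by linarith
qed

lemma zflows_empty: "zflows V t h {} q = {\<lambda>_. undefined}"
  by (auto simp: zflows_def excess_def)

text \<open>The recurrence builds the polynomial edge by edge: a loop multiplies by
  \<open>x - 1\<close>, any other edge gives contraction minus deletion, and the edgeless graph has
  the single empty flow.\<close>

lemma card_zflows_polynomial:
  assumes "finite E" "t \<in> E \<rightarrow> V" "h \<in> E \<rightarrow> V"
  shows "\<exists>p :: int poly. \<forall>q>0. poly p (int q) = int (card (zflows V t h E q))"
  using assms
proof (induction E arbitrary: V t h)
  case empty
  show ?case by (rule exI[of _ 1]) (simp add: zflows_empty)
next
  case (insert e E)
  then have "t \<in> E \<rightarrow> V" "h \<in> E \<rightarrow> V" by auto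
  from insert.IH[OF this] obtain p where p: "\<forall>q>0. poly p (int q) = int (card (zflows V t h E q))"
    by blast
  show ?case
  proof (cases "t e = h e")
    case True
    then show ?thesis
      using insert.hyps p by (intro exI[of _ "([:0, 1:] - 1) * p"])
        (auto simp: card_zflows_loop of_nat_diff)
  next
    case False
    have "redirect (t e) (h e) t \<in> E \<rightarrow> V - {h e}" "redirect (t e) (h e) h \<in> E \<rightarrow> V - {h e}"
      using insert.prems False by (auto simp: redirect_def split: if_splits)
    from insert.IH[OF this] obtain r where r: "\<forall>q>0. poly r (int q) = 
        int (card (zflows (V - {h e}) (redirect (t e) (h e) t) (redirect (t e) (h e) h) E q))"
      by blast
    have "poly (r - p) (int q) = int (card (zflows V t h (insert e E) q))" if "q > 0" for q
      using card_zflows_deletion_contraction[of E e t "t e" h "h e" V q] insert that False p r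
      by (auto simp flip: of_nat_add)
    then show ?thesis by blast
  qed
qed

section \<open>The Potts partition function\<close>

definition potts :: "'v set \<Rightarrow> ('e \<Rightarrow> 'v) \<Rightarrow> ('e \<Rightarrow> 'v) \<Rightarrow> 'e set \<Rightarrow> nat \<Rightarrow> int" where
  "potts V t h E q =
    (\<Sum>\<phi>\<in>V \<rightarrow>\<^sub>E {..<q}. \<Prod>e\<in>E. if \<phi> (t e) = \<phi> (h e) then int q - 1 else - 1)"

lemma potts_loop:
  assumes "finite E" "e \<notin> E" "t e = h e"
  shows "potts V t h (insert e E) q = (int q - 1) * potts V t h E q"
  unfolding potts_def sum_distrib_left prod.insert[OF assms(1,2)]
  by (simp only: assms(3) if_True simp_thms)

text \<open>The weight of \<open>e\<close> plus 1 is \<open>q\<close> if its ends share a colour and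
  0 otherwise. The surviving colourings, constant on \<open>e\<close>, are those of the
  contraction.\<close>

lemma potts_deletion_contraction:
  assumes fin: "finite E" "finite V" and e: "e \<notin> E" and ab: "t e = a" "h e = b" "a \<noteq> b"
    and V: "a \<in> V" "b \<in> V"
  shows "potts V t h (insert e E) q + potts V t h E q =
    int q * potts (V - {b}) (redirect a b t) (redirect a b h) E q"
proof -
  let ?w = "\<lambda>t h \<phi>. \<Prod>e\<in>E. if \<phi> (t e) = \<phi> (h e) then int q - 1 else - 1"
  let ?F = "V \<rightarrow>\<^sub>E {..<q}"
  have finF: "finite ?F" using fin by (auto intro: finite_PiE)
  have "potts V t h (insert e E) q + potts V t h E q =
      (\<Sum>\<phi>\<in>?F. if \<phi> a = \<phi> b then int q * ?w t h \<phi> else 0)"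
    using fin e ab by (auto simp: potts_def sum.distrib[symmetric] algebra_simps intro!: sum.cong)
  also have "\<dots> = (\<Sum>\<phi>\<in>{\<phi>\<in>?F. \<phi> a = \<phi> b}. int q * ?w t h \<phi>)"
    using finF by (simp add: sum.inter_filter)
  \<comment> \<open>A colouring that agrees at \<open>a\<close> and \<open>b\<close> is determined
    by its restriction to \<open>V - {b}\<close>; the inverse gives \<open>b\<close> the colour of
    \<open>a\<close>.\<close>
  also have "\<dots> = (\<Sum>\<psi>\<in>(V - {b}) \<rightarrow>\<^sub>E {..<q}. int q * ?w (redirect a b t) (redirect a b h) \<psi>)"
  proof (rule sum.reindex_bij_witness[where j = "\<lambda>\<phi>. restrict \<phi> (V - {b})" and i = "\<lambda>\<psi>. \<psi>(b := \<psi> a)"])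
    fix \<phi> assume \<phi>: "\<phi> \<in> {\<phi>\<in>?F. \<phi> a = \<phi> b}"
    then show "(restrict \<phi> (V - {b}))(b := restrict \<phi> (V - {b}) a) = \<phi>"
      using ab V by (auto simp: fun_eq_iff PiE_iff extensional_def restrict_def)
    show "restrict \<phi> (V - {b}) \<in> (V - {b}) \<rightarrow>\<^sub>E {..<q}"
      using \<phi> by (auto simp: PiE_iff)
  next
    fix \<psi> assume \<psi>: "\<psi> \<in> (V - {b}) \<rightarrow>\<^sub>E {..<q}"
    show "restrict (\<psi>(b := \<psi> a)) (V - {b}) = \<psi>"
      using \<psi> by (auto simp: fun_eq_iff PiE_iff extensional_def restrict_def)
    show "\<psi>(b := \<psi> a) \<in> {\<phi>\<in>?F. \<phi> a = \<phi> b}"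
      using \<psi> ab V by (auto simp: PiE_iff extensional_def)
  next
    fix \<phi> assume \<phi>: "\<phi> \<in> {\<phi>\<in>?F. \<phi> a = \<phi> b}"
    have *: "restrict \<phi> (V - {b}) (redirect a b t e) = \<phi> (t e)"
      "restrict \<phi> (V - {b}) (redirect a b h e) = \<phi> (h e)" for e
      using \<phi> ab V by (auto simp: redirect_def PiE_iff extensional_def)
    show "int q * ?w (redirect a b t) (redirect a b h) (restrict \<phi> (V - {b})) = int q * ?w t h \<phi>"
      by (simp only: *)
  qed
  finally show ?thesis
    by (simp add: potts_def sum_distrib_left)
qed

text \<open>Contraction loses one vertex, hence one power of \<open>q\<close>, which is the extra
  factor in the recurrence for \<open>potts\<close>. Without edges there is one flow, and each of
  the \<open>q ^ card V\<close> colourings has weight 1.\<close>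

lemma card_zflows_eq_potts:
  assumes "finite E" "finite V" "t \<in> E \<rightarrow> V" "h \<in> E \<rightarrow> V" "q > 0"
  shows "int q ^ card V * int (card (zflows V t h E q)) = potts V t h E q"
  using assms
proof (induction E arbitrary: V t h)
  case empty
  then show ?case by (simp add: zflows_empty potts_def card_PiE)
next
  case (insert e E)
  have IH: "int q ^ card V * int (card (zflows V t h E q)) = potts V t h E q"
    using insert by auto
  show ?case
  proof (cases "t e = h e")
    case True
    then show ?thesis
      using insert.hyps insert.prems IH by (simp add: card_zflows_loop potts_loop of_nat_diff mult.left_commute)
  next
    case False
    let ?t = "redirect (t e) (h e) t" and ?h = "redirect (t e) (h e) h"
    have V: "t e \<in> V" "h e \<in> V" using insert.prems by auto
    have "?t \<in> E \<rightarrow> V - {h e}" "?h \<in> E \<rightarrow> V - {h e}"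
      using insert.prems False by (auto simp: redirect_def split: if_splits)
    from insert.IH[OF _ this] insert.prems
    have *: "int q ^ card (V - {h e}) * int (card (zflows (V - {h e}) ?t ?h E q))
        = potts (V - {h e}) ?t ?h E q" by simp
    have "card V = Suc (card (V - {h e}))"
      using insert.prems(1) V(2) by (rule card.remove)
    then have "int q ^ card V = int q * int q ^ card (V - {h e})"
      by (simp only: power_Suc)
    then have "int q ^ card V * int (card (zflows (V - {h e}) ?t ?h E q))
        = potts V t h (insert e E) q + potts V t h E q"
      using * potts_deletion_contraction[of E V e t "t e" h "h e" q] insert.hyps insert.prems V False
      by (simp only: mult.assoc) simp
    then show ?thesis
      using card_zflows_deletion_contraction[of E e t "t e" h "h e" V q, symmetric] insert.hyps insert.prems V False IH
      by (simp add: algebra_simps)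
  qed
qed

section \<open>The exponential formula for colour classes\<close>

lemma sum_Pow_card:
  fixes f :: "nat \<Rightarrow> 'a::comm_semiring_1"
  assumes "finite V"
  shows "(\<Sum>A\<in>Pow V. f (card A)) = (\<Sum>i\<le>card V. of_nat (card V choose i) * f i)"
proof -
  have "(\<Sum>A\<in>Pow V. f (card A)) = (\<Sum>i\<le>card V. \<Sum>A\<in>{A\<in>Pow V. card A = i}. f (card A))"
    using assms by (intro sum.group[symmetric]) (auto intro: card_mono)
  also have "\<dots> = (\<Sum>i\<le>card V. of_nat (card V choose i) * f i)"
  proof (rule sum.cong[OF refl])
    fix i
    have "card {A\<in>Pow V. card A = i} = card V choose i"
      using n_subsets[OF assms, of i] by (simp add: Pow_def)
    then show "(\<Sum>A\<in>{A\<in>Pow V. card A = i}. f (card A)) = of_nat (card V choose i) * f i"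
      by (simp add: sum.cong)
  qed
  finally show ?thesis .
qed

text \<open>A product of exponential generating functions counts ways to split a set in two. Peeling
  off the class of one colour therefore yields one factor per colour; \<open>V\<close> varies in the
  induction because the remaining colours live on the complement.\<close>

lemma sum_over_maps_eq_fps_power:
  fixes g :: "nat \<Rightarrow> 'a::field_char_0"
  assumes "finite V"
  shows "(\<Sum>\<phi>\<in>V \<rightarrow>\<^sub>E {..<q}. \<Prod>c<q. g (card {v\<in>V. \<phi> v = c})) =
    fact (card V) * fps_nth (Abs_fps (\<lambda>i. g i / fact i) ^ q) (card V)"
  using assms
proof (induction q arbitrary: V)
  case 0
  then show ?case by (auto simp: PiE_eq_empty_iff card_eq_0_iff)
next
  case (Suc q)
  let ?f = "Abs_fps (\<lambda>i. g i / fact i)"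
  let ?w = "\<lambda>V \<phi>. \<Prod>c<q. g (card {v\<in>V. \<phi> v = c})"
  \<comment> \<open>A colouring corresponds to the class \<open>A\<close> of the last colour
    \<open>q\<close> together with a colouring of \<open>V - A\<close> by the colours below
    \<open>q\<close>.\<close>
  have "(\<Sum>\<phi>\<in>V \<rightarrow>\<^sub>E {..<Suc q}. \<Prod>c<Suc q. g (card {v\<in>V. \<phi> v = c})) =
     (\<Sum>(A, \<psi>)\<in>(SIGMA A:Pow V. (V - A) \<rightarrow>\<^sub>E {..<q}). g (card A) * ?w (V - A) \<psi>)"
  proof (rule sum.reindex_bij_witness[where
        j = "\<lambda>\<phi>. ({v\<in>V. \<phi> v = q}, restrict \<phi> {v\<in>V. \<phi> v \<noteq> q})" and
        i = "\<lambda>(A, \<psi>) v. if v \<in> A then q else \<psi> v"])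
    fix \<phi> assume \<phi>: "\<phi> \<in> V \<rightarrow>\<^sub>E {..<Suc q}"
    let ?j = "({v\<in>V. \<phi> v = q}, restrict \<phi> {v\<in>V. \<phi> v \<noteq> q})"
    show "(\<lambda>(A, \<psi>) v. if v \<in> A then q else \<psi> v) ?j = \<phi>"
      using \<phi> by (auto simp: fun_eq_iff PiE_iff extensional_def)
    show "?j \<in> (SIGMA A:Pow V. (V - A) \<rightarrow>\<^sub>E {..<q})"
      using \<phi> by (auto simp: PiE_iff extensional_def less_Suc_eq)
    have "{v \<in> V - {v \<in> V. \<phi> v = q}. restrict \<phi> {v\<in>V. \<phi> v \<noteq> q} v = c} = {v\<in>V. \<phi> v = c}"
      if "c < q" for c using that by auto
    then show "(\<lambda>(A, \<psi>). g (card A) * ?w (V - A) \<psi>) ?j =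
        (\<Prod>c<Suc q. g (card {v\<in>V. \<phi> v = c}))"
      by (simp add: mult.commute)
  next
    fix x assume x: "x \<in> (SIGMA A:Pow V. (V - A) \<rightarrow>\<^sub>E {..<q})"
    let ?i = "(\<lambda>(A, \<psi>) v. if v \<in> A then q else \<psi> v) x"
    obtain A \<psi> where [simp]: "x = (A, \<psi>)" by (cases x)
    have A: "A \<subseteq> V" and \<psi>: "\<And>v. v \<in> V - A \<Longrightarrow> \<psi> v < q" "\<And>v. v \<notin> V - A \<Longrightarrow> \<psi> v = undefined"
      using x by (auto simp: PiE_iff extensional_def)
    have [simp]: "{v\<in>V. ?i v = q} = A" using A \<psi> by force
    have [simp]: "{v\<in>V. ?i v \<noteq> q} = V - A" using A \<psi> by force
    show "({v\<in>V. ?i v = q}, restrict ?i {v\<in>V. ?i v \<noteq> q}) = x"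
      using A \<psi> by (simp only: \<open>{v\<in>V. ?i v = q} = A\<close> \<open>{v\<in>V. ?i v \<noteq> q} = V - A\<close>) (auto simp: fun_eq_iff)
    show "?i \<in> V \<rightarrow>\<^sub>E {..<Suc q}"
      using A \<psi> by (auto simp: PiE_iff extensional_def less_Suc_eq)
  qed
  also have "\<dots> = (\<Sum>A\<in>Pow V. \<Sum>\<psi>\<in>(V - A) \<rightarrow>\<^sub>E {..<q}. g (card A) * ?w (V - A) \<psi>)"
    using Suc.prems by (subst sum.Sigma) (auto intro!: finite_PiE)
  also have "\<dots> = (\<Sum>A\<in>Pow V. g (card A) * (fact (card (V - A)) * fps_nth (?f ^ q) (card (V - A))))"
  proof (rule sum.cong[OF refl])
    fix A
    have "finite (V - A)" using Suc.prems by simp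
    then show "(\<Sum>\<psi>\<in>(V - A) \<rightarrow>\<^sub>E {..<q}. g (card A) * ?w (V - A) \<psi>) =
        g (card A) * (fact (card (V - A)) * fps_nth (?f ^ q) (card (V - A)))"
      by (simp only: sum_distrib_left[symmetric] Suc.IH)
  qed
  also have "\<dots> = (\<Sum>A\<in>Pow V. g (card A) * (fact (card V - card A) * fps_nth (?f ^ q) (card V - card A)))"
    using Suc.prems by (intro sum.cong refl) (auto simp: card_Diff_subset finite_subset)
  also have "\<dots> = (\<Sum>i\<le>card V. of_nat (card V choose i) * (g i * (fact (card V - i) * fps_nth (?f ^ q) (card V - i))))"
    by (rule sum_Pow_card[OF Suc.prems])
  \<comment> \<open>Writing the binomial coefficient with factorials turns the sum into a Cauchy
    product.\<close>
  also have "\<dots> = fact (card V) * fps_nth (?f * ?f ^ q) (card V)"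
    unfolding fps_mult_nth sum_distrib_left atLeast0AtMost
    by (intro sum.cong refl) (simp add: binomial_fact field_simps)
  finally show ?case by simp
qed

section \<open>Polynomial dependence on the exponent\<close>

lemma range_poly_const: "(\<lambda>_. c) \<in> range (poly :: 'a::comm_ring_1 poly \<Rightarrow> _)"
  by (rule range_eqI[of _ _ "[:c:]"]) auto

lemma range_poly_id: "(\<lambda>x. x) \<in> range (poly :: 'a::comm_ring_1 poly \<Rightarrow> _)"
  by (rule range_eqI[of _ _ "[:0, 1:]"]) auto

lemma range_poly_add:
  fixes f g :: "'a::comm_ring_1 \<Rightarrow> 'a"
  assumes "f \<in> range poly" "g \<in> range poly"
  shows "(\<lambda>x. f x + g x) \<in> range poly"
proof -
  obtain p r where "f = poly p" "g = poly r" using assms by blast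
  then have "(\<lambda>x. f x + g x) = poly (p + r)" by auto
  then show ?thesis by (rule range_eqI)
qed

lemma range_poly_diff:
  fixes f g :: "'a::comm_ring_1 \<Rightarrow> 'a"
  assumes "f \<in> range poly" "g \<in> range poly"
  shows "(\<lambda>x. f x - g x) \<in> range poly"
proof -
  obtain p r where "f = poly p" "g = poly r" using assms by blast
  then have "(\<lambda>x. f x - g x) = poly (p - r)" by auto
  then show ?thesis by (rule range_eqI)
qed

lemma range_poly_mult:
  fixes f g :: "'a::comm_ring_1 \<Rightarrow> 'a"
  assumes "f \<in> range poly" "g \<in> range poly"
  shows "(\<lambda>x. f x * g x) \<in> range poly"
proof -
  obtain p r where "f = poly p" "g = poly r" using assms by blast
  then have "(\<lambda>x. f x * g x) = poly (p * r)" by auto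
  then show ?thesis by (rule range_eqI)
qed

lemma range_poly_power:
  fixes f :: "'a::comm_ring_1 \<Rightarrow> 'a"
  assumes "f \<in> range poly"
  shows "(\<lambda>x. f x ^ m) \<in> range poly"
proof -
  obtain p where "f = poly p" using assms by blast
  then have "(\<lambda>x. f x ^ m) = poly (p ^ m)" by auto
  then show ?thesis by (rule range_eqI)
qed

text \<open>Membership in \<open>range poly\<close> expresses that a function is polynomial without
  naming the polynomial, so these rules prove it by following the shape of the term.\<close>

lemmas range_poly_intros =
  range_poly_const range_poly_id range_poly_add range_poly_diff range_poly_mult range_poly_power

lemma range_poly_sum:
  fixes f :: "'i \<Rightarrow> 'a::comm_ring_1 \<Rightarrow> 'a"
  shows "(\<And>i. i \<in> A \<Longrightarrow> f i \<in> range poly) \<Longrightarrow> (\<lambda>x. \<Sum>i\<in>A. f i x) \<in> range poly"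
proof (induction A rule: infinite_finite_induct)
  case (insert i A)
  then have "(\<lambda>x. f i x + (\<Sum>j\<in>A. f j x)) \<in> range poly"
    by (intro range_poly_add) auto
  then show ?case using insert.hyps by simp
qed (simp_all add: range_poly_const)

lemma range_poly_prod:
  fixes f :: "'i \<Rightarrow> 'a::comm_ring_1 \<Rightarrow> 'a"
  shows "(\<And>i. i \<in> A \<Longrightarrow> f i \<in> range poly) \<Longrightarrow> (\<lambda>x. \<Prod>i\<in>A. f i x) \<in> range poly"
proof (induction A rule: infinite_finite_induct)
  case (insert i A)
  then have "(\<lambda>x. f i x * (\<Prod>j\<in>A. f j x)) \<in> range poly"
    by (intro range_poly_mult) auto
  then show ?case using insert.hyps by simp
qed (simp_all add: range_poly_const)

lemma range_poly_gbinomial: "(\<lambda>x::'a::field_char_0. x gchoose k) \<in> range poly"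
proof -
  have "(\<lambda>x::'a. x gchoose k) = (\<lambda>x. (\<Prod>i<k. x - of_nat i) * (1 / fact k))"
    by (simp add: gbinomial_prod_rev atLeast0LessThan)
  then show ?thesis by (simp only:) (intro range_poly_intros range_poly_prod)
qed

lemma range_poly_fps_power_nth:
  fixes f :: "'a::comm_ring_1 \<Rightarrow> 'a fps"
  assumes "\<And>m. (\<lambda>x. fps_nth (f x) m) \<in> range poly"
  shows "(\<lambda>x. fps_nth (f x ^ j) m) \<in> range poly"
proof (induction j arbitrary: m)
  case 0
  show ?case by (simp add: range_poly_intros)
next
  case (Suc j)
  show ?case
    unfolding power_Suc fps_mult_nth by (intro range_poly_intros range_poly_sum assms Suc)
qed

text \<open>Although \<open>x\<close> is both the exponent and a parameter of the series,
  coefficient \<open>m\<close> of the power is a finite sum over \<open>j \<le> m\<close> of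
  \<open>x gchoose j\<close> times a coefficient of \<open>(f x - 1) ^ j\<close>, each polynomial in
  \<open>x\<close>.\<close>

lemma range_poly_fps_gpower_nth:
  fixes f :: "'a::field_char_0 \<Rightarrow> 'a fps"
  assumes "\<And>m. (\<lambda>x. fps_nth (f x) m) \<in> range poly"
  shows "(\<lambda>x. fps_nth (fps_gpower (f x) x) m) \<in> range poly"
proof -
  have "(\<lambda>x. fps_nth (f x - 1) m) \<in> range poly" for m
    by (simp only: fps_sub_nth) (intro range_poly_intros assms)
  then show ?thesis
    unfolding fps_gpower_def fps_compose_nth fps_binomial_nth
    by (intro range_poly_sum range_poly_intros range_poly_gbinomial range_poly_fps_power_nth)
qed

text \<open>The binomial series with a natural exponent is \<open>(1 + fps_X) ^ q\<close>.
  Substituting \<open>f - 1\<close>, which has constant term 0, commutes with powers and sends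
  \<open>1 + fps_X\<close> to \<open>f\<close>.\<close>

lemma fps_gpower_of_nat:
  assumes "fps_nth f 0 = 1"
  shows "fps_gpower f (of_nat q) = f ^ q"
proof -
  have "fps_nth (f - 1) 0 = 0" using assms by simp
  then have "fps_gpower f (of_nat q) = ((1 + fps_X) oo (f - 1)) ^ q"
    unfolding fps_gpower_def fps_binomial_of_nat by (simp add: fps_compose_power)
  also have "(1 + fps_X) oo (f - 1) = f"
    using assms by (simp add: fps_compose_add_distrib)
  finally show ?thesis .
qed

text \<open>In characteristic 0 the positive integers are infinitely many roots of the
  difference.\<close>

lemma poly_eq_if_eq_on_pos_nats:
  fixes p r :: "'a::field_char_0 poly"
  assumes "\<And>q::nat. q > 0 \<Longrightarrow> poly p (of_nat q) = poly r (of_nat q)"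
  shows "p = r"
proof (rule ccontr)
  assume "p \<noteq> r"
  then have "finite {x. poly (p - r) x = 0}" by (intro poly_roots_finite) simp
  moreover have "(of_nat :: nat \<Rightarrow> 'a) ` {0<..} \<subseteq> {x. poly (p - r) x = 0}" using assms by auto
  ultimately have "finite ((of_nat :: nat \<Rightarrow> 'a) ` {0<..})" by (rule rev_finite_subset)
  then have "finite {0::nat<..}" by (rule finite_imageD) (simp add: inj_on_def)
  then show False using infinite_Ioi by blast
qed

lemma poly_map_poly_of_int:
  "poly (map_poly of_int p) (of_int a) = (of_int (poly p a) :: 'a::comm_ring_1)"
  by (induction p) (simp_all add: map_poly_pCons)

section \<open>The flow polynomial as a Potts sum\<close>

lemma flow_polynomial_unique:
  assumes "is_orientation G D0"
    and "\<And>q D. q > 0 \<Longrightarrow> is_orientation G D \<Longrightarrow> poly p (int q) = int (card (nowhere_zero_flows D q))"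
  shows "flow_polynomial G = p"
  unfolding flow_polynomial_def
proof (rule the_equality)
  \<comment> \<open>The orientation \<open>D0\<close> keeps the defining condition from being
    vacuous, so it fixes the values of \<open>r\<close> at all positive integers.\<close>
  fix r assume "\<forall>q>0. \<forall>D. is_orientation G D \<longrightarrow> poly r (int q) = int (card (nowhere_zero_flows D q))"
  then have "poly r (int q) = poly p (int q)" if "q > 0" for q
    using assms that by simp
  \<comment> \<open>The identity principle is stated over a field, hence the passage to rational
    coefficients.\<close>
  then have "map_poly of_int r = (map_poly of_int p :: rat poly)"
    by (intro poly_eq_if_eq_on_pos_nats)
      (metis of_int_of_nat_eq poly_map_poly_of_int)
  then have "of_int (coeff r i) = (of_int (coeff p i) :: rat)" for i
    by (metis coeff_map_poly of_int_0)
  then show "r = p" by (intro poly_eqI) simp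
qed (use assms in blast)

text \<open>The weight of an edge is symmetric in its two ends, so the Potts sum does not see the
  orientation.\<close>

lemma potts_swap_ends:
  fixes t h t' h' :: "'e \<Rightarrow> 'v"
  assumes "\<And>e. e \<in> E \<Longrightarrow> {t e, h e} = {t' e, h' e}"
  shows "potts V t h E q = potts V t' h' E q"
proof -
  have "(\<phi> (t e) = \<phi> (h e)) = (\<phi> (t' e) = \<phi> (h' e))" if "e \<in> E" for e and \<phi> :: "'v \<Rightarrow> nat"
    using assms[OF that] by (metis doubleton_eq_iff)
  then show ?thesis unfolding potts_def by (intro sum.cong prod.cong refl) simp
qed

lemma orientation_ends_in_vertices:
  assumes "is_orientation G D" "\<And>e. e \<in> edges G \<Longrightarrow> ends G e \<subseteq> vertices G"
  shows "tail D \<in> arcs D \<rightarrow> verts D" "head D \<in> arcs D \<rightarrow> verts D"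
proof -
  have "{tail D e, head D e} \<subseteq> verts D" if "e \<in> arcs D" for e
    using assms that by (metis is_orientation_def)
  then show "tail D \<in> arcs D \<rightarrow> verts D" "head D \<in> arcs D \<rightarrow> verts D" by auto
qed

text \<open>The flow counts of all orientations, multiplied by the same power of \<open>q\<close>,
  equal one Potts sum. Hence they agree, and the polynomial found for \<open>D0\<close> serves every
  orientation.\<close>

lemma flow_polynomial_eq_potts:
  assumes fin: "finite (vertices G)" "finite (edges G)"
    and ends: "\<And>e. e \<in> edges G \<Longrightarrow> ends G e \<subseteq> vertices G"
    and D0: "is_orientation G D0" and q: "q > 0"
  shows "int q ^ card (vertices G) * poly (flow_polynomial G) (int q) =
    potts (vertices G) (tail D0) (head D0) (edges G) q"
proof -
  have count: "int q ^ card (vertices G) * int (card (nowhere_zero_flows D q)) =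
      potts (vertices G) (tail D0) (head D0) (edges G) q" if D: "is_orientation G D" and q: "q > 0" for D q
  proof -
    have [simp]: "verts D = vertices G" "arcs D = edges G" using D by (auto simp: is_orientation_def)
    have "int q ^ card (vertices G) * int (card (nowhere_zero_flows D q)) =
        potts (vertices G) (tail D) (head D) (edges G) q"
      using fin q orientation_ends_in_vertices[OF D ends]
      by (simp add: nowhere_zero_flows_eq_zflows card_zflows_eq_potts)
    also have "\<dots> = potts (vertices G) (tail D0) (head D0) (edges G) q"
      using D D0 by (intro potts_swap_ends) (auto simp: is_orientation_def)
    finally show ?thesis .
  qed
  have [simp]: "verts D0 = vertices G" "arcs D0 = edges G" using D0 by (auto simp: is_orientation_def)
  obtain p where p: "\<And>q. q > 0 \<Longrightarrow> poly p (int q) = int (card (nowhere_zero_flows D0 q))"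
    using card_zflows_polynomial[OF fin(2), of "tail D0" "vertices G" "head D0"]
      orientation_ends_in_vertices[OF D0 ends] fin by (auto simp: nowhere_zero_flows_eq_zflows)
  have "flow_polynomial G = p"
  proof (rule flow_polynomial_unique[OF D0])
    fix q :: nat and D assume q: "q > 0" and D: "is_orientation G D"
    have "int q ^ card (vertices G) * int (card (nowhere_zero_flows D q)) =
      int q ^ card (vertices G) * int (card (nowhere_zero_flows D0 q))"
      using count[OF D q] count[OF D0 q] by simp
    then show "poly p (int q) = int (card (nowhere_zero_flows D q))"
      using q p by simp
  qed
  then show ?thesis using count[OF D0 q] p[OF q] by simp
qed

section \<open>Complete graphs\<close>

lemma card_doubletons: "finite V \<Longrightarrow> card {e. e \<subseteq> V \<and> card e = 2} = card V * (card V - 1) div 2"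
  by (simp add: n_subsets choose_two)

text \<open>Sorted by their common colour, the monochromatic edges are the two-element subsets of
  the colour classes, and distinct classes share none.\<close>

lemma card_monochromatic_edges:
  fixes q :: nat
  assumes "finite V" "\<phi> \<in> V \<rightarrow> {..<q}"
  shows "card {e. e \<subseteq> V \<and> card e = 2 \<and> (\<exists>c. \<phi> ` e = {c})} =
    (\<Sum>c<q. card {v\<in>V. \<phi> v = c} * (card {v\<in>V. \<phi> v = c} - 1) div 2)"
proof -
  have "{e. e \<subseteq> V \<and> card e = 2 \<and> (\<exists>c. \<phi> ` e = {c})} =
      (\<Union>c<q. {e. e \<subseteq> {v\<in>V. \<phi> v = c} \<and> card e = 2})" (is "?L = ?R")
  proof
    show "?L \<subseteq> ?R" 
    proof
      fix e assume "e \<in> ?L"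
      then obtain c where c: "e \<subseteq> V" "card e = 2" "\<phi> ` e = {c}" by blast
      then obtain v where "v \<in> e" by blast
      with c have "\<phi> v = c" "v \<in> V" by auto
      then have "c < q" using assms by auto
      then show "e \<in> ?R" using c by auto
    qed
    show "?R \<subseteq> ?L"
    proof
      fix e assume "e \<in> ?R"
      then obtain c where c: "e \<subseteq> {v\<in>V. \<phi> v = c}" "card e = 2" by auto
      then have "e \<noteq> {}" by auto
      then have "\<phi> ` e = {c}" using c by auto
      then show "e \<in> ?L" using c by auto
    qed
  qed
  moreover have "card ?R = (\<Sum>c<q. card {e. e \<subseteq> {v\<in>V. \<phi> v = c} \<and> card e = 2})"
  proof (rule card_UN_disjoint)
    show "\<forall>c\<in>{..<q}. finite {e. e \<subseteq> {v\<in>V. \<phi> v = c} \<and> card e = 2}"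
      using assms(1) by (auto intro: finite_subset[of _ "Pow V"])
    show "\<forall>c\<in>{..<q}. \<forall>d\<in>{..<q}. c \<noteq> d \<longrightarrow>
      {e. e \<subseteq> {v\<in>V. \<phi> v = c} \<and> card e = 2} \<inter> {e. e \<subseteq> {v\<in>V. \<phi> v = d} \<and> card e = 2} = {}"
    proof (intro ballI impI, rule equals0I)
      fix c d e
      assume "c \<noteq> d" and e: "e \<in> {e. e \<subseteq> {v\<in>V. \<phi> v = c} \<and> card e = 2} \<inter>
        {e. e \<subseteq> {v\<in>V. \<phi> v = d} \<and> card e = 2}"
      then have "e \<noteq> {}" by auto
      then obtain v where "v \<in> e" by blast
      then show False using e \<open>c \<noteq> d\<close> by auto
    qed
  qed simp
  ultimately show ?thesis using assms(1) by (simp add: card_doubletons)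
qed

text \<open>Taking \<open>-1\<close> out of every edge weight gives the global sign and leaves
  \<open>1 - q\<close> for each monochromatic edge and 1 for the others.\<close>

lemma potts_complete:
  assumes fin: "finite V" and E: "E = {e. e \<subseteq> V \<and> card e = 2}"
    and th: "\<And>e. e \<in> E \<Longrightarrow> e = {t e, h e}"
  shows "potts V t h E q = (-1) ^ (card V * (card V - 1) div 2) *
    (\<Sum>\<phi>\<in>V \<rightarrow>\<^sub>E {..<q}. \<Prod>c<q.
      (1 - int q) ^ (card {v\<in>V. \<phi> v = c} * (card {v\<in>V. \<phi> v = c} - 1) div 2))"
proof -
  have finE: "finite E" using fin E by (auto intro: finite_subset[of _ "Pow V"])
  have "(\<Prod>e\<in>E. if \<phi> (t e) = \<phi> (h e) then int q - 1 else - 1) =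
      (-1) ^ (card V * (card V - 1) div 2) * (\<Prod>c<q.
      (1 - int q) ^ (card {v\<in>V. \<phi> v = c} * (card {v\<in>V. \<phi> v = c} - 1) div 2))"
    if \<phi>: "\<phi> \<in> V \<rightarrow>\<^sub>E {..<q}" for \<phi>
  proof -
    have mono: "(\<phi> (t e) = \<phi> (h e)) = (\<exists>c. \<phi> ` e = {c})" if "e \<in> E" for e
      by (subst th[OF that]) auto
    have "(\<Prod>e\<in>E. if \<phi> (t e) = \<phi> (h e) then int q - 1 else - 1) =
        (\<Prod>e\<in>E. (- 1) * (if \<exists>c. \<phi> ` e = {c} then 1 - int q else 1))"
      by (intro prod.cong refl) (simp add: mono)
    also have "\<dots> = (-1) ^ card E * (\<Prod>e\<in>E. if \<exists>c. \<phi> ` e = {c} then 1 - int q else 1)"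
      by (simp only: prod.distrib prod_constant)
    also have "(\<Prod>e\<in>E. if \<exists>c. \<phi> ` e = {c} then 1 - int q else 1) =
        (1 - int q) ^ card {e\<in>E. \<exists>c. \<phi> ` e = {c}}"
      by (simp only: prod.inter_filter[OF finE, symmetric] prod_constant)
    also have "card {e\<in>E. \<exists>c. \<phi> ` e = {c}} =
        (\<Sum>c<q. card {v\<in>V. \<phi> v = c} * (card {v\<in>V. \<phi> v = c} - 1) div 2)"
      using card_monochromatic_edges[OF fin, of \<phi> q] \<phi> by (auto simp: E conj_assoc)
    finally show ?thesis using fin by (simp add: power_sum E card_doubletons)
  qed
  then show ?thesis by (simp add: potts_def sum_distrib_left)
qed

theorem corollary4:
  fixes n :: nat and x :: "'a::field_char_0"
  assumes "n > 0" and "x \<noteq> 0"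
  shows "poly (map_poly of_int (flow_polynomial (complete_ugraph n))) x =
           (-1) ^ (n * (n - 1) div 2) / x ^ n *
           fps_nth
             (fps_nth_deriv n
               (fps_gpower
                 (\<Sum>i = 0..n. fps_const (1 / fact i * (1 - x) ^ (i * (i - 1) div 2)) * fps_X ^ i) x))
             0"
proof -
  let ?G = "complete_ugraph n"
  let ?s = "(-1) ^ (n * (n - 1) div 2) :: 'a"
  define f :: "'a \<Rightarrow> 'a fps" where
    "f x = (\<Sum>i = 0..n. fps_const (1 / fact i * (1 - x) ^ (i * (i - 1) div 2)) * fps_X ^ i)" for x
  have f_nth: "fps_nth (f x) m = (if m \<le> n then 1 / fact m * (1 - x) ^ (m * (m - 1) div 2) else 0)" for x m
    by (simp add: f_def fps_sum_nth fps_X_power_nth if_distrib[of "\<lambda>z. _ * z"] cong: if_cong)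
  \<comment> \<open>Any orientation would do; here each edge points from its smaller to its larger
    vertex.\<close>
  define D where "D = \<lparr>verts = {1..n}, arcs = edges ?G, tail = Min, head = Max\<rparr>"
  have Min_Max: "e = {Min e, Max e}" if e: "card e = 2" for e :: "nat set"
  proof -
    obtain x y where xy: "e = {x, y}" "x \<noteq> y" using e by (auto simp: card_2_iff)
    then show ?thesis by (cases x y rule: linorder_cases) (auto simp: min_def max_def)
  qed
  have D: "is_orientation ?G D"
    using Min_Max by (simp add: is_orientation_def D_def complete_ugraph_def)
  have finE: "finite (edges ?G)"
    by (auto simp: complete_ugraph_def intro: finite_subset[of _ "Pow {1..n}"])
  have at_nat: "of_nat q ^ n * poly (map_poly of_int (flow_polynomial ?G)) (of_nat q) =
      ?s * (fact n * fps_nth (fps_gpower (f (of_nat q)) (of_nat q)) n)" if q: "q > 0" for q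
  proof -
    \<comment> \<open>Cutting \<open>g\<close> off beyond \<open>n\<close> makes
      \<open>f (of_nat q)\<close> exactly its exponential generating function. Colour classes have
      at most \<open>n\<close> elements, so the sum over colourings is unaffected.\<close>
    define g where "g i = (if i \<le> n then (1 - of_nat q) ^ (i * (i - 1) div 2) else 0 :: 'a)" for i
    have g: "f (of_nat q) = Abs_fps (\<lambda>i. g i / fact i)"
      by (auto simp: fps_eq_iff f_nth g_def)
    have "int q ^ n * poly (flow_polynomial ?G) (int q) = potts {1..n} Min Max (edges ?G) q"
      using flow_polynomial_eq_potts[OF _ finE _ D q] by (auto simp: complete_ugraph_def D_def)
    also have "\<dots> = (-1) ^ (n * (n - 1) div 2) * (\<Sum>\<phi>\<in>{1..n} \<rightarrow>\<^sub>E {..<q}. \<Prod>c<q.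
        (1 - int q) ^ (card {v\<in>{1..n}. \<phi> v = c} * (card {v\<in>{1..n}. \<phi> v = c} - 1) div 2))"
      using potts_complete[of "{1..n}" "edges ?G" Min Max q] Min_Max by (simp add: complete_ugraph_def)
    finally have "of_int (int q ^ n * poly (flow_polynomial ?G) (int q)) = (of_int \<dots> :: 'a)"
      by (rule arg_cong)
    then have "of_nat q ^ n * of_int (poly (flow_polynomial ?G) (int q)) =
      ?s * (\<Sum>\<phi>\<in>{1..n} \<rightarrow>\<^sub>E {..<q}. \<Prod>c<q.
        (1 - of_nat q) ^ (card {v\<in>{1..n}. \<phi> v = c} * (card {v\<in>{1..n}. \<phi> v = c} - 1) div 2))"
      by simp
    also have "\<dots> = ?s * (\<Sum>\<phi>\<in>{1..n} \<rightarrow>\<^sub>E {..<q}. \<Prod>c<q. g (card {v\<in>{1..n}. \<phi> v = c}))"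
    proof -
      have "card {v\<in>{1..n}. \<phi> v = c} \<le> n" for \<phi> and c :: nat
        by (rule order_trans[OF card_mono[of "{1..n}"]]) auto
      then show ?thesis by (simp add: g_def)
    qed
    also have "\<dots> = ?s * (fact n * fps_nth (f (of_nat q) ^ q) n)"
      using sum_over_maps_eq_fps_power[of "{1..n}" g q] by (simp add: g)
    also have "f (of_nat q) ^ q = fps_gpower (f (of_nat q)) (of_nat q)"
      by (rule fps_gpower_of_nat[symmetric]) (simp add: f_nth)
    finally show ?thesis
      using poly_map_poly_of_int[of "flow_polynomial ?G" "int q", where ?'a = 'a] by simp
  qed
  have "(\<lambda>x. fps_nth (f x) m) \<in> range poly" for m
    by (cases "m \<le> n") (simp_all only: f_nth if_True if_False, (intro range_poly_intros)+)
  then have "(\<lambda>x. ?s * (fact n * fps_nth (fps_gpower (f x) x) n)) \<in> range poly"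
    by (intro range_poly_intros range_poly_fps_gpower_nth)
  then obtain r where r: "\<And>x. poly r x = ?s * (fact n * fps_nth (fps_gpower (f x) x) n)"
    by (metis (mono_tags, lifting) rangeE)
  \<comment> \<open>Multiplying by \<open>x ^ n\<close> clears the denominator, so that
    \<open>at_nat\<close> compares two polynomials at the positive integers.\<close>
  have "monom 1 n * map_poly of_int (flow_polynomial ?G) = r"
    by (rule poly_eq_if_eq_on_pos_nats) (simp add: r at_nat poly_monom)
  then have "x ^ n * poly (map_poly of_int (flow_polynomial ?G)) x =
      ?s * (fact n * fps_nth (fps_gpower (f x) x) n)"
    using r[of x] by (auto simp: poly_monom)
  \<comment> \<open>The derivative at 0 supplies the factor \<open>fact n\<close> that the
    exponential formula produced.\<close>
  moreover have "fps_nth (fps_nth_deriv n (fps_gpower (f x) x)) 0 = fact n * fps_nth (fps_gpower (f x) x) n"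
    by (simp add: fps_deriv_maclauren_0)
  ultimately show ?thesis
    using assms(2) unfolding f_def by (simp add: field_simps)
qed

end
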